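(* Let $K\in\mathbb{N}$, $\lambda,\mu>0$. Let $\theta\in\mathbb{R}$ and $\Delta(0),\dots,\Delta(K-1)\in\mathbb{R}$ satisfy $$m(\Delta(i))\,\mathbf 1_{\{i\le K-1\}}+\frac{i\mu}{\lambda}\,\Delta(i-1)=\frac{\theta}{\lambda}\qquad\text{for all } i\in\{0,1,\dots,K\}$$ (for $i=0$ the second term is absent). Let $(u_0^*,\dots,u_{K-1}^* )$ be the optimal price vector, where $u_i^*\in\arg\max_{u}(u-\Delta(i))\overline{G}(u)$ for $i\in\{0,\dots,K-1\}$. Then: (a) $\theta\ge0$; (b) $\Delta(i)$ are positive and increasing in $i\in\{0,\dots,K-1\}$; (c) $u_i^*$ are also increasing in $i\in\{0,\dots,K-1\}$.
   Context: $V$ is a positive random variable (the valuation of a job) with continuous distribution function $G$ and finite mean, and $\overline{G}(u)=P(V\ge u)$ for $u\in\mathbb{R}$. For $B\in\mathbb{R}$, $m(B)=\max_{u}(u-B)\overline{G}(u)$. The displayed system is the optimality (Bellman) equation for the problem of maximizing the long-run average revenue of a $K$-server loss system with Poisson($\lambda$) arrivals, exponential($\mu$) service times, i.i.d. valuations distributed as $V$, where the state is the number $i$ of busy servers, and an arriving job joins and pays the posted price $u$ iff its valuation is at least $u$ and some server is idle; $\theta$ is the optimal revenue rate, and the optimal price in state $i$ is a maximizer $u_i^*$ of $(u-\Delta(i))\overline{G}(u)$. *)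

theory Defs
  imports "HOL-Probability.Probability"
begin

definition tail_prob :: "'a measure \<Rightarrow> ('a \<Rightarrow> real) \<Rightarrow> real \<Rightarrow> real" where
  "tail_prob M V u = \<P>(\<omega> in M. u \<le> V \<omega>)"

definition price_gain :: "'a measure \<Rightarrow> ('a \<Rightarrow> real) \<Rightarrow> real \<Rightarrow> real \<Rightarrow> real" where
  "price_gain M V B u = (u - B) * tail_prob M V u"

(* A maximum over all real prices, negative ones included. Being a GREATEST rather than a
   supremum, it is meaningful only where the maximum is attained, which is the case for every B
   when V is integrable with a continuous distribution function. *)
definition max_gain :: "'a measure \<Rightarrow> ('a \<Rightarrow> real) \<Rightarrow> real \<Rightarrow> real" where
  "max_gain M V B = (GREATEST y. y \<in> range (price_gain M V B))"

end

theory Submission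
  imports Defs
begin

text \<open>
  Write \<open>m\<close> for the maximal gain. It is nonnegative, nonincreasing in the opportunity cost,
  strictly decreasing where it is positive, and positive at nonpositive costs.
  The equations for \<open>i = 0\<close> and \<open>i = K\<close> give \<open>m (\<Delta> 0) = \<theta> / lam\<close> and
  \<open>\<Delta> (K - 1) = \<theta> / (K mu)\<close>, which force \<open>\<theta> > 0\<close>. If \<open>\<Delta> 0 \<le> 0\<close>, the equations propagate
  nonpositivity up to \<open>\<Delta> (K - 1) > 0\<close>, a contradiction; so \<open>\<Delta> 0 > 0\<close>, and subtracting
  consecutive equations shows inductively that \<open>m (\<Delta> i)\<close> strictly decreases, hence that
  \<open>\<Delta> i\<close> strictly increases. Prices increase by the usual exchange argument; a tie could only
  occur at a price with zero demand, which is excluded because \<open>m (\<Delta> i) > 0\<close> for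
  \<open>i < K - 1\<close>.
\<close>

lemma (in prob_space) tail_prob_antimono:
  assumes "random_variable borel V" "x \<le> y"
  shows "tail_prob M V y \<le> tail_prob M V x"
  unfolding tail_prob_def using assms by (intro finite_measure_mono) auto

lemma tail_prob_nonneg: "0 \<le> tail_prob M V x"
  by (simp add: tail_prob_def)

text \<open>Otherwise \<open>V\<close> would lie below each \<open>inverse (real (Suc n))\<close>
  almost surely, hence below all of them at once, contradicting positivity.\<close>

lemma (in prob_space) ex_pos_tail_prob:
  assumes [measurable]: "random_variable borel V" and pos: "AE \<omega> in M. 0 < V \<omega>"
  shows "\<exists>p>0. 0 < tail_prob M V p"
proof (rule ccontr)
  assume "\<not> ?thesis"
  then have zero: "tail_prob M V p = 0" if "0 < p" for p
    using that tail_prob_nonneg[of M V p] by force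
  have "AE \<omega> in M. \<not> inverse (real (Suc n)) \<le> V \<omega>" for n
    using zero[of "inverse (real (Suc n))"] prob_Collect_eq_0[of "\<lambda>\<omega>. inverse (real (Suc n)) \<le> V \<omega>"]
    by (simp add: tail_prob_def)
  then have "AE \<omega> in M. \<forall>n. \<not> inverse (real (Suc n)) \<le> V \<omega>"
    by (simp add: AE_all_countable)
  with pos have "AE \<omega> in M. False"
  proof eventually_elim
    case (elim \<omega>)
    then show ?case using reals_Archimedean[of "V \<omega>"] by (auto simp: not_le dest: less_asym)
  qed
  then show False by simp
qed

lemma max_gain_eq:
  assumes "is_arg_max (price_gain M V B) (\<lambda>_. True) x"
  shows "max_gain M V B = price_gain M V B x"
  unfolding max_gain_def using assms
  by (intro Greatest_equality) (auto simp: is_arg_max_linorder)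

lemma price_gain_le_max_gain:
  assumes "is_arg_max (price_gain M V B) (\<lambda>_. True) x"
  shows "price_gain M V B y \<le> max_gain M V B"
  using assms unfolding max_gain_eq[OF assms] by (simp add: is_arg_max_linorder)

lemma max_gain_nonneg:
  assumes "is_arg_max (price_gain M V B) (\<lambda>_. True) x"
  shows "0 \<le> max_gain M V B"
  \<comment> \<open>Posting the price \<open>B\<close> itself earns exactly zero.\<close>
  using price_gain_le_max_gain[OF assms, of B] by (simp add: price_gain_def)

lemma (in prob_space) max_gain_pos:
  assumes "random_variable borel V" "AE \<omega> in M. 0 < V \<omega>"
    and "is_arg_max (price_gain M V B) (\<lambda>_. True) x" "B \<le> 0"
  shows "0 < max_gain M V B"
proof -
  obtain p where p: "0 < p" "0 < tail_prob M V p"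
    using ex_pos_tail_prob[OF assms(1,2)] by blast
  with \<open>B \<le> 0\<close> have "0 < price_gain M V B p" by (simp add: price_gain_def)
  also have "\<dots> \<le> max_gain M V B" by (rule price_gain_le_max_gain[OF assms(3)])
  finally show ?thesis .
qed

text \<open>Test the price \<open>y\<close>, optimal for \<open>C\<close>, in the problem with cost
  \<open>B\<close>: its gain changes by exactly the correction term. Both monotonicity lemmas follow
  from the sign of that term.\<close>

lemma max_gain_shift:
  assumes "is_arg_max (price_gain M V B) (\<lambda>_. True) x"
    and "is_arg_max (price_gain M V C) (\<lambda>_. True) y"
  shows "max_gain M V C + (C - B) * tail_prob M V y \<le> max_gain M V B"
  using price_gain_le_max_gain[OF assms(1), of y] max_gain_eq[OF assms(2)]
  by (simp add: price_gain_def algebra_simps)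

lemma max_gain_antimono:
  assumes "is_arg_max (price_gain M V B) (\<lambda>_. True) x"
    and "is_arg_max (price_gain M V C) (\<lambda>_. True) y" and "B \<le> C"
  shows "max_gain M V C \<le> max_gain M V B"
proof -
  have "0 \<le> (C - B) * tail_prob M V y" using \<open>B \<le> C\<close> by (simp add: tail_prob_nonneg)
  with max_gain_shift[OF assms(1,2)] show ?thesis by linarith
qed

lemma max_gain_strict_antimono:
  assumes "is_arg_max (price_gain M V B) (\<lambda>_. True) x"
    and "is_arg_max (price_gain M V C) (\<lambda>_. True) y" and "B < C" "0 < max_gain M V C"
  shows "max_gain M V C < max_gain M V B"
proof -
  have "tail_prob M V y \<noteq> 0"
    using \<open>0 < max_gain M V C\<close> by (auto simp: max_gain_eq[OF assms(2)] price_gain_def)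
  then have "0 < (C - B) * tail_prob M V y"
    using \<open>B < C\<close> tail_prob_nonneg[of M V y] by simp
  with max_gain_shift[OF assms(1,2)] show ?thesis by linarith
qed

lemma (in prob_space) optimal_price_mono:
  assumes rv: "random_variable borel V"
    and x: "is_arg_max (price_gain M V B) (\<lambda>_. True) x"
    and y: "is_arg_max (price_gain M V C) (\<lambda>_. True) y"
    and "B < C" "0 < max_gain M V B"
  shows "x \<le> y"
proof (rule ccontr)
  assume "\<not> x \<le> y"
  then have "y < x" by simp
  let ?G = "tail_prob M V"
  have B: "(y - B) * ?G y \<le> (x - B) * ?G x" and C: "(x - C) * ?G x \<le> (y - C) * ?G y"
    using x y by (auto simp: is_arg_max_linorder price_gain_def)
  \<comment> \<open>Adding the two optimality inequalities cancels the revenues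
    \<open>x * ?G x\<close> and \<open>y * ?G y\<close>.\<close>
  then have "0 \<le> (C - B) * (?G x - ?G y)" by (simp add: algebra_simps)
  then have "?G y \<le> ?G x" using \<open>B < C\<close> by (simp add: zero_le_mult_iff)
  with tail_prob_antimono[OF rv] \<open>y < x\<close> have "?G y = ?G x" by (simp add: antisym)
  \<comment> \<open>At equal demand the higher price \<open>x\<close> would earn strictly more,
    unless that demand is zero.\<close>
  with C have "(x - y) * ?G x \<le> 0" by (simp add: algebra_simps)
  then have "?G x = 0"
    using \<open>y < x\<close> tail_prob_nonneg[of M V x] by (simp add: mult_le_0_iff)
  with \<open>0 < max_gain M V B\<close> show False by (simp add: max_gain_eq[OF x] price_gain_def)
qed

theorem lemma18:
  fixes M :: "'a measure" and V :: "'a \<Rightarrow> real"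
    and K :: nat and lam mu \<theta> :: real and \<Delta> u :: "nat \<Rightarrow> real"
  assumes "prob_space M"
    and "V \<in> borel_measurable M"
    and "AE \<omega> in M. 0 < V \<omega>"
    and "continuous_on UNIV (cdf (distr M borel V))"
    and "integrable M V"
    and "0 < lam" and "0 < mu"
    and "\<forall>i\<in>{0..K}.
           (if i < K then max_gain M V (\<Delta> i) else 0)
           + (if i = 0 then 0 else real i * mu / lam * \<Delta> (i - 1)) = \<theta> / lam"
    and "\<forall>i<K. is_arg_max (price_gain M V (\<Delta> i)) (\<lambda>_. True) (u i)"
  shows "0 \<le> \<theta>
    \<and> ((\<forall>i<K. 0 < \<Delta> i) \<and> strict_mono_on {..<K} \<Delta>)
    \<and> mono_on {..<K} u"
proof -
  interpret prob_space M by fact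
  note rv = \<open>V \<in> borel_measurable M\<close>
  note arg = assms(9)[rule_format]
  let ?m = "\<lambda>i. max_gain M V (\<Delta> i)"
  define c where "c = mu / lam"
  have c: "0 < c" using assms by (simp add: c_def)
  have bellman: "(if i < K then ?m i else 0) + (if i = 0 then 0 else real i * c * \<Delta> (i - 1))
      = \<theta> / lam" if "i \<le> K" for i
    using bspec[OF assms(8), of i] that
    by (simp only: c_def times_divide_eq_right atLeastAtMost_iff le0 simp_thms)
  have bellman_Suc: "?m (Suc i) + real (Suc i) * c * \<Delta> i = \<theta> / lam" if "Suc i < K" for i
    using bellman[of "Suc i"] that by simp
  show ?thesis
  proof (cases K)
    case 0
    with bellman[of 0] \<open>0 < lam\<close> have "\<theta> = 0" by simp
    with 0 show ?thesis by (simp add: strict_mono_on_def mono_on_def)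
  next
    case (Suc n)
    have m0: "?m 0 = \<theta> / lam" using bellman[of 0] Suc by simp
    have mK: "real K * c * \<Delta> n = \<theta> / lam" using bellman[of K] Suc by simp
    have nonneg: "0 \<le> ?m i" if "i < K" for i using max_gain_nonneg[OF arg[OF that]] .
    have pos: "0 < ?m i" if "i < K" "\<Delta> i \<le> 0" for i
      using max_gain_pos[OF rv assms(3) arg] that by blast
    have "\<theta> / lam \<noteq> 0"
    proof
      assume zero: "\<theta> / lam = 0"
      with m0 pos[of 0] Suc have "0 < \<Delta> 0" by force
      \<comment> \<open>The equation for state 1 bounds \<open>\<Delta> 0\<close>; if
        \<open>K = 1\<close> it is the boundary equation, without a gain term.\<close>
      moreover have "\<Delta> 0 \<le> 0"
      proof (cases n)
        case 0
        then show ?thesis using mK zero c Suc by simp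
      next
        case (Suc k)
        then have "1 < K" using \<open>K = Suc n\<close> by simp
        with bellman_Suc[of 0] nonneg[of 1] zero have "c * \<Delta> 0 \<le> 0" by simp
        then show ?thesis using c by (simp add: mult_le_0_iff)
      qed
      ultimately show False by simp
    qed
    moreover have "0 \<le> \<theta> / lam" using m0 nonneg[of 0] Suc by simp
    ultimately have t: "0 < \<theta> / lam" by linarith
    have \<Delta>n: "0 < \<Delta> n"
    proof -
      have "0 < real K * c" using c Suc by simp
      with mK t show ?thesis by (metis zero_less_mult_pos)
    qed
    have \<Delta>0: "0 < \<Delta> 0"
    proof (rule ccontr)
      assume "\<not> 0 < \<Delta> 0"
      have "\<Delta> i \<le> 0" if "i < K" for i
        using that
      proof (induction i)
        case (Suc i)
        then have "real (Suc i) * c * \<Delta> i \<le> 0" using c by (simp add: mult_nonneg_nonpos)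
        with bellman_Suc[OF \<open>Suc i < K\<close>] m0 have "?m 0 \<le> ?m (Suc i)" by linarith
        \<comment> \<open>A cost above \<open>\<Delta> 0\<close> would push the positive value
          \<open>?m (Suc i)\<close> strictly below \<open>?m 0\<close>.\<close>
        have "\<Delta> (Suc i) \<le> \<Delta> 0"
        proof (rule ccontr)
          assume "\<not> \<Delta> (Suc i) \<le> \<Delta> 0"
          moreover have "0 < ?m (Suc i)" using \<open>?m 0 \<le> ?m (Suc i)\<close> m0 t by linarith
          moreover have "0 < K" using \<open>K = Suc n\<close> by simp
          ultimately have "?m (Suc i) < ?m 0"
            using max_gain_strict_antimono[OF arg arg] Suc.prems by simp
          with \<open>?m 0 \<le> ?m (Suc i)\<close> show False by simp
        qed
        with \<open>\<not> 0 < \<Delta> 0\<close> show ?case by simp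
      qed (use \<open>\<not> 0 < \<Delta> 0\<close> in simp)
      with \<Delta>n Suc show False by force
    qed
    \<comment> \<open>Contrapositive of weak antitonicity, so no positivity of the gain is
      required.\<close>
    have step: "\<Delta> i < \<Delta> (Suc i)" if "Suc i < K" "?m (Suc i) < ?m i" for i
      using max_gain_antimono[OF arg[of "Suc i"] arg[of i]] that by fastforce
    have m_dec: "0 < \<Delta> i \<and> ?m (Suc i) < ?m i" if "Suc i < K" for i
      using that
    proof (induction i)
      case 0
      have "0 < c * \<Delta> 0" using c \<Delta>0 by simp
      with bellman_Suc[of 0] 0 m0 \<Delta>0 show ?case by simp
    next
      case (Suc i)
      then have "0 < \<Delta> i" "\<Delta> i < \<Delta> (Suc i)" using step[of i] by auto
      \<comment> \<open>Both the coefficient and the positive cost grow; as the right-hand sides of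
        the two equations agree, the gain must drop.\<close>
      have "real (Suc i) * c * \<Delta> i < real (Suc (Suc i)) * c * \<Delta> (Suc i)"
        using \<open>\<Delta> i < \<Delta> (Suc i)\<close>
        by (intro mult_strict_mono[of "real (Suc i) * c"]) (use c \<open>0 < \<Delta> i\<close> in auto)
      with bellman_Suc[of i] bellman_Suc[of "Suc i"] Suc.prems \<open>0 < \<Delta> i\<close> \<open>\<Delta> i < \<Delta> (Suc i)\<close>
      show ?case by simp
    qed
    \<comment> \<open>\<open>m_dec\<close> stops before the last state \<open>n\<close>, which
      \<open>\<Delta>n\<close> supplies.\<close>
    have \<Delta>_pos: "0 < \<Delta> i" if "i < K" for i
      using that m_dec[of i] \<Delta>n Suc by (cases "i = n") auto
    have \<Delta>_less: "\<Delta> i < \<Delta> j" if "i < j" "j < K" for i j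
      using that
    proof (induction rule: less_Suc_induct)
      case (1 i)
      then show ?case using step m_dec by blast
    qed auto
    have u_le: "u i \<le> u j" if "i < j" "j < K" for i j
    proof (rule optimal_price_mono[OF rv arg arg])
      \<comment> \<open>Positivity is asked only at the lower state \<open>i\<close>, so the gain at
        the last state may vanish.\<close>
      show "0 < ?m i" using m_dec[of i] nonneg[of "Suc i"] that by simp
    qed (use that \<Delta>_less in auto)
    have "0 \<le> \<theta>" using t \<open>0 < lam\<close> by (simp add: zero_less_divide_iff)
    moreover have "strict_mono_on {..<K} \<Delta>" using \<Delta>_less by (simp add: strict_mono_on_def)
    moreover have "mono_on {..<K} u"
      using u_le by (auto simp: mono_on_def le_less)
    ultimately show ?thesis using \<Delta>_pos by blast
  qed
qed

end
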